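(* Let $k\ge2$, $g\in C^k(\mathbb{R}^n)$ and $u(x,t)=\min_{|x-y|\le t}g(y)$. Then $T_1=\Gamma\setminus\Sigma$.
   Context: $|\cdot|$ is the Euclidean norm. $u$ is the Hopf–Lax solution of $u_t+|\nabla u|=0$ with $u(\cdot,0)=g$. A point $y$ is a minimizer for $(x,t)$ if $|y-x|\le t$ and $u(x,t)=g(y)$. For $y$ with $Dg(y)\ne0$ put $X(y,t)=y+\frac{Dg(y)}{|Dg(y)|}t$, and let $X_y(y,t)$ be its Jacobian matrix in $y$. Define, in $[0,\infty]$, $\overline t_s(y)=\sup\{t>0 : y$ is the unique minimizer for $(X(y,t),t)\}$ and $t_s(y)=\inf\{t>0 : y$ is not a minimizer for $(X(y,t),t)\}$ (with $\sup\emptyset=0$, $\inf\emptyset=\infty$); one has $\overline t_s\le t_s$. $M=\{y : Dg(y)\neq0,\ \overline t_s(y)<\infty\}$, and $T(M)$ is the set of points $(X(y,t),t)$ with $y\in M$ and $t\in[\overline t_s(y),t_s(y)]$ if $t_s(y)<\infty$, $t\in[\overline t_s(y),\infty)$ if $t_s(y)=\infty$. $\Sigma\subset\mathbb{R}^n\times\{t>0\}$ is the set of points where $u$ is not differentiable. $T_1$ is the set of points of $T(M)$ that have a unique minimizer. $\Gamma$ is the set of conjugate points: $(x,t)$ with $t>0$ is conjugate if there exists $y\in\mathbb{R}^n$ with $Dg(y)\neq0$, $x=X(y,t)$, $y$ a minimizer for $(x,t)$, and $\det X_y(y,t)=0$. *)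

theory Defs
  imports "HOL-Analysis.Analysis"
begin

text \<open>
  \<open>Ck k f\<close>: all iterated partial derivatives of \<open>f\<close> up to order \<open>k\<close> exist and are continuous.
  Requiring (Frechet) differentiability rather than just existence of the partials
  makes no difference, since the partials are themselves required to be continuous.
\<close>

primrec Ck :: "nat \<Rightarrow> (real ^ 'n \<Rightarrow> real) \<Rightarrow> bool" where
  "Ck 0 f \<longleftrightarrow> continuous_on UNIV f"
| "Ck (Suc k) f \<longleftrightarrow>
     (\<forall>x. f differentiable (at x)) \<and>
     (\<forall>i. Ck k (\<lambda>x. frechet_derivative f (at x) (axis i 1)))"

definition grad :: "(real ^ 'n \<Rightarrow> real) \<Rightarrow> real ^ 'n \<Rightarrow> real ^ 'n" where
  "grad f x = (\<chi> i. frechet_derivative f (at x) (axis i 1))"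

lemma GDERIV_grad:
  assumes "f differentiable (at x)"
  shows "GDERIV f x :> grad f x"
proof -
  let ?D = "frechet_derivative f (at x)"
  have D: "(f has_derivative ?D) (at x)"
    using assms by (simp add: frechet_derivative_works)
  then have lin: "linear ?D"
    by (rule has_derivative_linear)
  have "?D h = inner h (grad f x)" for h
  proof -
    have "?D h = ?D (\<Sum>i\<in>UNIV. (h $ i) *\<^sub>R axis i 1)"
      by (simp add: basis_expansion flip: scalar_mult_eq_scaleR)
    also have "\<dots> = (\<Sum>i\<in>UNIV. h $ i * ?D (axis i 1))"
      using lin by (simp add: linear_sum linear_cmul)
    finally show ?thesis
      by (simp add: inner_vec_def grad_def)
  qed
  then have "?D = (\<lambda>h. inner h (grad f x))"
    by blast
  then show ?thesis
    using D by (simp add: gderiv_def)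
qed

text \<open>
  For continuous \<open>g\<close> and \<open>t \<ge> 0\<close> the infimum is a minimum, see \<open>hopf_lax_attained\<close>;
  for \<open>t < 0\<close> the value is irrelevant.
\<close>

definition hopf_lax :: "(real ^ 'n \<Rightarrow> real) \<Rightarrow> real ^ 'n \<Rightarrow> real \<Rightarrow> real" where
  "hopf_lax g x t = (INF y\<in>cball x t. g y)"

lemma hopf_lax_attained:
  assumes "continuous_on UNIV g" "0 \<le> t"
  shows "\<exists>y\<in>cball x t. hopf_lax g x t = g y \<and> (\<forall>z\<in>cball x t. g y \<le> g z)"
proof -
  have "\<exists>y\<in>cball x t. \<forall>z\<in>cball x t. g y \<le> g z"
    using assms by (intro continuous_attains_inf) (auto intro: continuous_on_subset)
  then obtain y where y: "y \<in> cball x t" "\<And>z. z \<in> cball x t \<Longrightarrow> g y \<le> g z"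
    by blast
  then have "hopf_lax g x t = g y"
    unfolding hopf_lax_def by (intro cInf_eq_minimum) auto
  with y show ?thesis by blast
qed

definition minimizer :: "(real ^ 'n \<Rightarrow> real) \<Rightarrow> real ^ 'n \<Rightarrow> real ^ 'n \<Rightarrow> real \<Rightarrow> bool" where
  "minimizer g y x t \<longleftrightarrow> norm (y - x) \<le> t \<and> hopf_lax g x t = g y"

definition unique_minimizer :: "(real ^ 'n \<Rightarrow> real) \<Rightarrow> real ^ 'n \<Rightarrow> real ^ 'n \<Rightarrow> real \<Rightarrow> bool" where
  "unique_minimizer g y x t \<longleftrightarrow> minimizer g y x t \<and> (\<forall>z. minimizer g z x t \<longrightarrow> z = y)"

text \<open>Only meaningful where \<open>grad g y \<noteq> 0\<close>; every use below is guarded accordingly.\<close>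

definition flow :: "(real ^ 'n \<Rightarrow> real) \<Rightarrow> real ^ 'n \<Rightarrow> real \<Rightarrow> real ^ 'n" where
  "flow g y t = y + (t / norm (grad g y)) *\<^sub>R grad g y"

text \<open>In \<^typ>\<open>ennreal\<close>, \<open>Sup {} = 0\<close> and \<open>Inf {} = \<infinity>\<close>.\<close>

definition t_bar :: "(real ^ 'n \<Rightarrow> real) \<Rightarrow> real ^ 'n \<Rightarrow> ennreal" where
  "t_bar g y = (SUP t\<in>{t. 0 < t \<and> unique_minimizer g y (flow g y t) t}. ennreal t)"

definition t_s :: "(real ^ 'n \<Rightarrow> real) \<Rightarrow> real ^ 'n \<Rightarrow> ennreal" where
  "t_s g y = (INF t\<in>{t. 0 < t \<and> \<not> minimizer g y (flow g y t) t}. ennreal t)"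

definition M_set :: "(real ^ 'n \<Rightarrow> real) \<Rightarrow> (real ^ 'n) set" where
  "M_set g = {y. grad g y \<noteq> 0 \<and> t_bar g y < \<infinity>}"

text \<open>
  As \<open>t\<close> is real, \<open>ennreal t \<le> t_s g y\<close> covers both \<open>t \<in> [t_bar, t_s]\<close> for finite \<open>t_s\<close>
  and \<open>t \<in> [t_bar, \<infinity>)\<close> for infinite \<open>t_s\<close>. The condition \<open>0 \<le> t\<close> is needed because
  \<open>ennreal\<close> maps negative reals to \<open>0\<close>.
\<close>

definition TM_set :: "(real ^ 'n \<Rightarrow> real) \<Rightarrow> ((real ^ 'n) \<times> real) set" where
  "TM_set g = {(flow g y t, t) | y t.
     y \<in> M_set g \<and> 0 \<le> t \<and> t_bar g y \<le> ennreal t \<and> ennreal t \<le> t_s g y}"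

definition T1_set :: "(real ^ 'n \<Rightarrow> real) \<Rightarrow> ((real ^ 'n) \<times> real) set" where
  "T1_set g = {(x, t). (x, t) \<in> TM_set g \<and> (\<exists>y. unique_minimizer g y x t)}"

definition singular_set :: "(real ^ 'n \<Rightarrow> real) \<Rightarrow> ((real ^ 'n) \<times> real) set" where
  "singular_set g =
     {(x, t). 0 < t \<and> \<not> (\<lambda>(x, t). hopf_lax g x t) differentiable (at (x, t))}"

definition conjugate_set :: "(real ^ 'n \<Rightarrow> real) \<Rightarrow> ((real ^ 'n) \<times> real) set" where
  "conjugate_set g = {(x, t). 0 < t \<and>
     (\<exists>y. grad g y \<noteq> 0 \<and> x = flow g y t \<and> minimizer g y x t \<and>
          det (jacobian (\<lambda>z. flow g z t) (at y)) = 0)}"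

end

theory Submission
  imports Defs
begin

text \<open>
  Let \<open>\<nu> = sgn (grad g y)\<close> for a point \<open>y\<close> with \<open>grad g y \<noteq> 0\<close>. The balls
  \<open>cball (flow g y t) t\<close> have centre \<open>y + t *\<^sub>R \<nu>\<close>; they grow with \<open>t\<close> and all touch the level
  hypersurface of \<open>g\<close> through \<open>y\<close> at \<open>y\<close>. So the set of times for which \<open>y\<close> is a minimizer for
  \<open>(flow g y t, t)\<close> is an interval starting at \<open>0\<close>, closed on the right by continuity, and the set
  of times for which it is the unique minimizer is an interval with supremum \<open>t_bar g y\<close>. This
  supremum is positive, because the level hypersurface has bounded curvature at \<open>y\<close>. A point
  \<open>(x, t)\<close> with \<open>t > 0\<close> and a minimizer \<open>y\<close> of nonzero gradient necessarily has \<open>x = flow g y t\<close>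
  (\<open>constrained_minimum_on_normal\<close>). Two equivalences then give the theorem.

  \<^bold>\<open>Regularity is uniqueness.\<close> Suppose that \<open>(x, t)\<close>, \<open>t > 0\<close>, has a minimizer of nonzero gradient.
  If the Hopf-Lax function is differentiable there, its spatial gradient equals \<open>grad g z\<close> at
  every minimizer \<open>z\<close>, so \<open>z = x - t *\<^sub>R sgn (grad g z)\<close> is determined. Conversely, if the
  minimizer is unique, the minimizers of nearby points are close to it, and comparing
  competitors at equal relative position in the two balls shows differentiability (Danskin's
  argument; \<open>hopf_lax_differentiable_if_unique\<close>).

  \<^bold>\<open>Conjugacy is degeneracy of the second-order condition.\<close> Let \<open>H\<close> be the Hessian of \<open>g\<close> at \<open>y\<close>.
  On the tangent hyperplane \<open>h \<bullet> \<nu> = 0\<close>, the second-order condition for \<open>y\<close> to minimize \<open>g\<close> on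
  the ball of radius \<open>t\<close> is that the form
  \<open>Q\<^sub>t h = H h \<bullet> h + norm (grad g y) / t * (norm h)\<^sup>2\<close> is nonnegative. While it is nonnegative, its
  null vectors are exactly the kernel of the Jacobian matrix of \<open>flow g _ t\<close> at \<open>y\<close>. The form
  decreases strictly in \<open>t\<close>, so a null vector at time \<open>t\<close> makes the condition fail at every later
  time, and \<open>t_bar g y \<le> t\<close>. If there is no null vector, then \<open>Q\<^sub>t\<close> is positive definite, which is
  an open condition, and a unique minimizer at time \<open>t\<close> stays a unique minimizer slightly
  longer (\<open>strict_min_persists\<close>), so \<open>t < t_bar g y\<close>.
\<close>

section \<open>First- and second-order expansions\<close>

lemma continuous_on_of_GDERIV:
  assumes "\<And>x. GDERIV f x :> G x"
  shows "continuous_on UNIV f"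
  using assms unfolding gderiv_def
  by (meson continuous_at_imp_continuous_on has_derivative_continuous)

lemma DERIV_along_line:
  fixes f :: "'a::real_inner \<Rightarrow> real"
  assumes "\<And>x. GDERIV f x :> G x"
  shows "((\<lambda>s. f (p + s *\<^sub>R w)) has_real_derivative (G (p + s *\<^sub>R w) \<bullet> w)) (at s)"
proof -
  have "((\<lambda>s. p + s *\<^sub>R w) has_derivative (\<lambda>h. h *\<^sub>R w)) (at s)"
    by (auto intro!: derivative_eq_intros)
  from has_derivative_compose[OF this assms[of "p + s *\<^sub>R w", unfolded gderiv_def]]
  show ?thesis
    by (simp add: has_field_derivative_def inner_commute mult.commute[of _ "_ \<bullet> _"])
qed

text \<open>
  Both endpoints may vary here. The lower bound in Danskin's argument needs this: the
  points compared there depend on the perturbation.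
\<close>

lemma strict_differentiability:
  fixes f :: "'a::real_inner \<Rightarrow> real"
  assumes grad: "\<And>x. GDERIV f x :> G x" and cont: "isCont G y" and "e > 0"
  obtains d where "d > 0"
    "\<And>a b. \<lbrakk>norm (a - y) < d; norm (b - y) < d\<rbrakk> \<Longrightarrow> \<bar>f a - f b - G y \<bullet> (a - b)\<bar> \<le> e * norm (a - b)"
proof -
  obtain d where d: "d > 0" "\<And>x. norm (x - y) < d \<Longrightarrow> norm (G x - G y) < e"
    using cont \<open>e > 0\<close> unfolding continuous_at_eps_delta dist_norm by blast
  have "\<bar>f a - f b - G y \<bullet> (a - b)\<bar> \<le> e * norm (a - b)"
    if a: "norm (a - y) < d" and b: "norm (b - y) < d" for a b
  proof -
    obtain s where s: "0 < s" "s < 1"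
      "f (b + 1 *\<^sub>R (a - b)) - f (b + 0 *\<^sub>R (a - b)) = (1 - 0) * (G (b + s *\<^sub>R (a - b)) \<bullet> (a - b))"
      using MVT2[of 0 1 "\<lambda>s. f (b + s *\<^sub>R (a - b))" "\<lambda>s. G (b + s *\<^sub>R (a - b)) \<bullet> (a - b)"]
        DERIV_along_line[OF grad] by auto
    define x where "x = b + s *\<^sub>R (a - b)"
    have "x \<in> ball y d"
    proof -
      have "x = (1 - s) *\<^sub>R b + s *\<^sub>R a"
        by (simp add: x_def algebra_simps)
      then show ?thesis
        using convexD[OF convex_ball, of b y d a "1 - s" s] a b s
        by (auto simp: dist_norm norm_minus_commute)
    qed
    then have "norm (G x - G y) \<le> e"
      using d(2)[of x] by (simp add: dist_norm norm_minus_commute)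
    have "f a - f b - G y \<bullet> (a - b) = (G x - G y) \<bullet> (a - b)"
      using s(3) by (simp add: x_def inner_diff_left)
    also have "\<bar>\<dots>\<bar> \<le> norm (G x - G y) * norm (a - b)"
      by (rule Cauchy_Schwarz_ineq2)
    also have "\<dots> \<le> e * norm (a - b)"
      using \<open>norm (G x - G y) \<le> e\<close> by (rule mult_right_mono) simp
    finally show ?thesis .
  qed
  with d(1) show ?thesis
    using that by blast
qed

text \<open>
  An increment of \<open>f\<close> based at the moving point \<open>y + a\<close>. The case \<open>a = 0\<close> is Taylor's formula with
  Peano remainder; comparing two ways around a parallelogram gives the symmetry of \<open>H\<close>.
  Subtracting the claimed polynomial from \<open>f\<close> along the segment from \<open>y + a\<close> to \<open>y + a + w\<close> leaves a
  function whose derivative is the linearization error of \<open>G\<close>, so the mean value theorem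
  applies.
\<close>

lemma second_order_increment:
  fixes f :: "'a::real_inner \<Rightarrow> real"
  assumes grad: "\<And>x. GDERIV f x :> G x" and hess: "(G has_derivative H) (at y)" and "e > 0"
  obtains d where "d > 0"
    "\<And>a w. norm a + norm w < d \<Longrightarrow>
       \<bar>f (y + a + w) - f (y + a) - (G y \<bullet> w + H a \<bullet> w + H w \<bullet> w / 2)\<bar> \<le> e * (norm a + norm w) * norm w"
proof -
  obtain d where d: "d > 0" "\<And>x. norm (x - y) < d \<Longrightarrow> norm (G x - G y - H (x - y)) \<le> e * norm (x - y)"
    using hess \<open>e > 0\<close> unfolding has_derivative_at_alt by blast
  have lin: "linear H"
    using hess by (rule has_derivative_linear)
  have "\<bar>f (y + a + w) - f (y + a) - (G y \<bullet> w + H a \<bullet> w + H w \<bullet> w / 2)\<bar> \<le> e * (norm a + norm w) * norm w"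
    if small: "norm a + norm w < d" for a w
  proof -
    define \<phi> where "\<phi> s = f ((y + a) + s *\<^sub>R w) - (s * (G y \<bullet> w) + s * (H a \<bullet> w) + s\<^sup>2 * (H w \<bullet> w / 2))" for s
    have "(\<phi> has_real_derivative
        (G ((y + a) + s *\<^sub>R w) \<bullet> w - (G y \<bullet> w + H a \<bullet> w + s * (H w \<bullet> w)))) (at s)" for s
      unfolding \<phi>_def by (auto intro!: derivative_eq_intros DERIV_along_line[OF grad])
    then obtain s where s: "0 < s" "s < 1"
      "\<phi> 1 - \<phi> 0 = (1 - 0) * (G ((y + a) + s *\<^sub>R w) \<bullet> w - (G y \<bullet> w + H a \<bullet> w + s * (H w \<bullet> w)))"
      using MVT2[of 0 1 \<phi> "\<lambda>s. G ((y + a) + s *\<^sub>R w) \<bullet> w - (G y \<bullet> w + H a \<bullet> w + s * (H w \<bullet> w))"]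
      by auto
    define x where "x = a + s *\<^sub>R w"
    have nx: "norm x \<le> norm a + norm w"
    proof -
      have "norm x \<le> norm a + s * norm w"
        unfolding x_def using norm_triangle_ineq[of a "s *\<^sub>R w"] s by simp
      also have "s * norm w \<le> norm w"
        using s by (simp add: mult_left_le_one_le)
      finally show ?thesis by simp
    qed
    have "f (y + a + w) - f (y + a) - (G y \<bullet> w + H a \<bullet> w + H w \<bullet> w / 2) = \<phi> 1 - \<phi> 0"
      by (simp add: \<phi>_def)
    also have "\<dots> = (G (y + x) - G y - H x) \<bullet> w"
      using s(3) lin by (simp add: x_def linear_add linear_cmul inner_diff_left inner_add_left add.assoc)
    also have "\<bar>\<dots>\<bar> \<le> norm (G (y + x) - G y - H x) * norm w"
      by (rule Cauchy_Schwarz_ineq2)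
    also have "\<dots> \<le> e * norm x * norm w"
      using d(2)[of "y + x"] nx small by (intro mult_right_mono) auto
    also have "\<dots> \<le> e * (norm a + norm w) * norm w"
      using nx \<open>e > 0\<close> by (intro mult_right_mono mult_left_mono) auto
    finally show ?thesis .
  qed
  with d(1) show ?thesis
    using that by blast
qed

lemma second_order_Taylor:
  fixes f :: "'a::real_inner \<Rightarrow> real"
  assumes grad: "\<And>x. GDERIV f x :> G x" and hess: "(G has_derivative H) (at y)" and "e > 0"
  obtains d where "d > 0"
    "\<And>w. norm w < d \<Longrightarrow> \<bar>f (y + w) - f y - (G y \<bullet> w + H w \<bullet> w / 2)\<bar> \<le> e * (norm w)\<^sup>2"
proof -
  obtain d where d: "d > 0" "\<And>a w. norm a + norm w < d \<Longrightarrow>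
       \<bar>f (y + a + w) - f (y + a) - (G y \<bullet> w + H a \<bullet> w + H w \<bullet> w / 2)\<bar> \<le> e * (norm a + norm w) * norm w"
    using second_order_increment[OF assms] by blast
  have "\<bar>f (y + w) - f y - (G y \<bullet> w + H w \<bullet> w / 2)\<bar> \<le> e * (norm w)\<^sup>2" if "norm w < d" for w
    using d(2)[of 0 w] that linear_0[OF has_derivative_linear[OF hess]]
    by (simp add: power2_eq_square mult.assoc)
  with d(1) show ?thesis
    using that by blast
qed

lemma hessian_symmetric:
  fixes f :: "'a::real_inner \<Rightarrow> real"
  assumes grad: "\<And>x. GDERIV f x :> G x" and hess: "(G has_derivative H) (at y)"
  shows "H h \<bullet> k = H k \<bullet> h"
proof -
  have lin: "linear H"
    using hess by (rule has_derivative_linear)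
  define C where "C = norm h + norm k"
  have small: "\<bar>H h \<bullet> k - H k \<bullet> h\<bar> \<le> e" if "e > 0" for e
  proof -
    define D where "D = C\<^sup>2 + 1"
    have D: "D > 0" "C\<^sup>2 \<le> D"
      by (simp_all add: D_def add_nonneg_pos)
    define e' where "e' = e / (4 * D)"
    have "e' > 0"
      using that D by (simp add: e'_def)
    then obtain d where d: "d > 0" "\<And>a w. norm a + norm w < d \<Longrightarrow>
       \<bar>f (y + a + w) - f (y + a) - (G y \<bullet> w + H a \<bullet> w + H w \<bullet> w / 2)\<bar> \<le> e' * (norm a + norm w) * norm w"
      using second_order_increment[OF grad hess] by blast
    define s where "s = d / (2 * (C + 1))"
    have "C \<ge> 0"
      by (simp add: C_def)
    then have "s > 0" "s * C < d"
      using \<open>d > 0\<close> by (simp_all add: s_def field_simps add_nonneg_pos)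
    define a b where "a = s *\<^sub>R h" and "b = s *\<^sub>R k"
    have ab: "norm a + norm b = s * C"
      using \<open>s > 0\<close> by (simp add: a_def b_def C_def algebra_simps)
    have bound: "\<bar>f (y + p + q) - f (y + p) - (G y \<bullet> q + H p \<bullet> q + H q \<bullet> q / 2)\<bar> \<le> e' * (s * C)\<^sup>2"
      if "norm p + norm q \<le> s * C" for p q
    proof -
      have "\<bar>f (y + p + q) - f (y + p) - (G y \<bullet> q + H p \<bullet> q + H q \<bullet> q / 2)\<bar>
          \<le> e' * (norm p + norm q) * norm q"
        using d(2) that \<open>s * C < d\<close> by force
      also have "\<dots> = e' * ((norm p + norm q) * norm q)"
        by simp
      also have "\<dots> \<le> e' * ((s * C) * (s * C))"
      proof -
        have "norm q \<le> s * C"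
          using that norm_ge_zero[of p] by linarith
        then show ?thesis
          using that \<open>e' > 0\<close> \<open>s > 0\<close> \<open>C \<ge> 0\<close> by (intro mult_left_mono mult_mono) auto
      qed
      finally show ?thesis
        by (simp add: power2_eq_square)
    qed
    have H0: "H 0 = 0"
      using lin by (rule linear_0)
    \<comment> \<open>The two ways around the parallelogram with opposite corners \<open>y\<close> and \<open>y + a + b\<close> give the
      same increment of \<open>f\<close>; all terms but the mixed ones cancel.\<close>
    have *: "\<bar>H a \<bullet> b - H b \<bullet> a\<bar> \<le> 4 * (e' * (s * C)\<^sup>2)"
      using bound[of a b] bound[of b a] bound[of 0 a] bound[of 0 b] ab H0
        norm_ge_zero[of a] norm_ge_zero[of b]
      by (simp add: add.commute add.left_commute abs_le_iff)
    have "H a \<bullet> b - H b \<bullet> a = s\<^sup>2 * (H h \<bullet> k - H k \<bullet> h)"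
      using lin by (simp add: a_def b_def linear_cmul power2_eq_square algebra_simps)
    then have "s\<^sup>2 * \<bar>H h \<bullet> k - H k \<bullet> h\<bar> \<le> s\<^sup>2 * (4 * e' * C\<^sup>2)"
      using * by (simp add: abs_mult power_mult_distrib mult_ac)
    then have "\<bar>H h \<bullet> k - H k \<bullet> h\<bar> \<le> 4 * e' * C\<^sup>2"
      using \<open>s > 0\<close> by simp
    also have "\<dots> \<le> 4 * e' * D"
      using D \<open>e' > 0\<close> by (intro mult_left_mono) auto
    also have "\<dots> = e"
      using D by (simp add: e'_def)
    finally show ?thesis .
  qed
  have "\<bar>H h \<bullet> k - H k \<bullet> h\<bar> \<le> 0"
    by (rule field_le_epsilon) (simp add: small)
  then show ?thesis by simp
qed

section \<open>Minimizing a function on balls with a common boundary point\<close>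

lemma norm_diff_scaleR_unit:
  fixes \<nu> w :: "'a::real_inner"
  assumes "norm \<nu> = 1"
  shows "(norm (w - t *\<^sub>R \<nu>))\<^sup>2 = (norm w)\<^sup>2 - 2 * t * (\<nu> \<bullet> w) + t\<^sup>2"
proof -
  have "\<nu> \<bullet> \<nu> = 1"
    using assms by (simp flip: power2_norm_eq_inner)
  then show ?thesis
    unfolding power2_norm_eq_inner
    by (simp add: inner_diff_left inner_diff_right inner_commute[of w \<nu>] power2_eq_square algebra_simps)
qed

text \<open>
  The variational inequality \<open>G y \<bullet> (z - y) \<ge> 0\<close> holds for every \<open>z\<close> in the ball. Its strongest
  instance is the point \<open>z\<close> of the ball that lies farthest in direction \<open>- G y\<close>, and that instance
  forces \<open>y = z\<close>.
\<close>

lemma constrained_minimum_on_normal: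
  fixes f :: "'a::real_inner \<Rightarrow> real"
  assumes grad: "\<And>x. GDERIV f x :> G x" and "G y \<noteq> 0"
    and y: "y \<in> cball x t" and min: "\<And>z. z \<in> cball x t \<Longrightarrow> f y \<le> f z"
  shows "x = y + t *\<^sub>R sgn (G y)"
proof -
  define \<nu> where "\<nu> = sgn (G y)"
  have \<nu>: "norm \<nu> = 1" "\<nu> \<bullet> \<nu> = 1"
    using \<open>G y \<noteq> 0\<close> by (simp_all add: \<nu>_def norm_sgn flip: power2_norm_eq_inner)
  have G: "G y \<bullet> w = norm (G y) * (\<nu> \<bullet> w)" for w
    using \<open>G y \<noteq> 0\<close> by (simp add: \<nu>_def sgn_div_norm)
  have "t \<ge> 0"
    using y by (meson dist_not_less_zero mem_cball not_less order_trans)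
  define z where "z = x - t *\<^sub>R \<nu>"
  have z: "z \<in> cball x t"
    using \<nu> \<open>t \<ge> 0\<close> by (simp add: z_def dist_norm)
  have "0 \<le> G y \<bullet> (z - y)"
  proof (rule ccontr)
    assume "\<not> 0 \<le> G y \<bullet> (z - y)"
    then have "G (y + 0 *\<^sub>R (z - y)) \<bullet> (z - y) < 0"
      by simp
    from DERIV_neg_dec_right[OF DERIV_along_line[OF grad, of y "z - y"] this]
    obtain d where d: "d > 0" "\<And>h. 0 < h \<Longrightarrow> h < d \<Longrightarrow> f (y + h *\<^sub>R (z - y)) < f y"
      by auto
    define h where "h = min 1 (d / 2)"
    have h: "0 < h" "h < d" "h \<le> 1"
      using d(1) by (auto simp: h_def)
    have "(1 - h) *\<^sub>R y + h *\<^sub>R z \<in> cball x t"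
      using h by (intro convexD[OF convex_cball y z]) auto
    then have "f y \<le> f (y + h *\<^sub>R (z - y))"
      using min by (simp add: algebra_simps)
    with d(2)[OF h(1,2)] show False by simp
  qed
  then have "0 \<le> \<nu> \<bullet> (z - y)"
    using G[of "z - y"] \<open>G y \<noteq> 0\<close> by (simp add: zero_le_mult_iff)
  then have *: "t \<le> \<nu> \<bullet> (x - y)"
    using \<nu> by (simp add: z_def inner_diff_right)
  have "(norm (x - y - t *\<^sub>R \<nu>))\<^sup>2 = (norm (x - y))\<^sup>2 - 2 * t * (\<nu> \<bullet> (x - y)) + t\<^sup>2"
    using \<nu>(1) by (rule norm_diff_scaleR_unit)
  moreover have "(norm (x - y))\<^sup>2 \<le> t\<^sup>2"
    using y by (intro power_mono) (auto simp: dist_norm)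
  moreover have "2 * t * t \<le> 2 * t * (\<nu> \<bullet> (x - y))"
    using * \<open>t \<ge> 0\<close> by (intro mult_left_mono) auto
  ultimately have "(norm (x - y - t *\<^sub>R \<nu>))\<^sup>2 \<le> 0"
    by (simp add: power2_eq_square)
  then show ?thesis
    by (simp add: \<nu>_def algebra_simps)
qed

text \<open>
  The radius enters this description of a ball through \<open>y\<close> with inner normal \<open>\<nu>\<close> only as a linear
  factor. Membership is thus a quadratic inequality in \<open>z - y\<close>, to be set against the Taylor
  expansion of \<open>f\<close> at \<open>y\<close>.
\<close>

lemma mem_tangent_ball_iff:
  fixes y \<nu> z :: "'a::real_inner"
  assumes "norm \<nu> = 1" "t \<ge> 0"
  shows "z \<in> cball (y + t *\<^sub>R \<nu>) t \<longleftrightarrow> (norm (z - y))\<^sup>2 \<le> 2 * t * (\<nu> \<bullet> (z - y))"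
proof -
  have "z \<in> cball (y + t *\<^sub>R \<nu>) t \<longleftrightarrow> norm (z - y - t *\<^sub>R \<nu>) \<le> t"
    by (simp add: dist_norm norm_minus_commute algebra_simps)
  also have "\<dots> \<longleftrightarrow> (norm (z - y - t *\<^sub>R \<nu>))\<^sup>2 \<le> t\<^sup>2"
    using \<open>t \<ge> 0\<close> by (simp add: power2_le_iff_abs_le)
  also have "(norm (z - y - t *\<^sub>R \<nu>))\<^sup>2 = (norm (z - y))\<^sup>2 - 2 * t * (\<nu> \<bullet> (z - y)) + t\<^sup>2"
    using assms(1) by (rule norm_diff_scaleR_unit)
  finally show ?thesis by simp
qed

lemma tangent_balls_mono:
  fixes y \<nu> :: "'a::real_inner"
  assumes "norm \<nu> = 1" "0 \<le> s" "s \<le> t"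
  shows "cball (y + s *\<^sub>R \<nu>) s \<subseteq> cball (y + t *\<^sub>R \<nu>) t"
proof
  fix z assume "z \<in> cball (y + s *\<^sub>R \<nu>) s"
  moreover have "dist (y + t *\<^sub>R \<nu>) (y + s *\<^sub>R \<nu>) = t - s"
    using assms by (simp add: dist_norm flip: scaleR_left_diff_distrib)
  ultimately show "z \<in> cball (y + t *\<^sub>R \<nu>) t"
    using dist_triangle[of "y + t *\<^sub>R \<nu>" z "y + s *\<^sub>R \<nu>"] by simp
qed

lemma quadratic_form_bound:
  fixes H :: "'a::real_inner \<Rightarrow> 'a"
  assumes "bounded_linear H"
  obtains K where "K > 0" "\<And>w. \<bar>H w \<bullet> w\<bar> \<le> K * (norm w)\<^sup>2"
proof -
  obtain K where K: "K > 0" "\<And>w. norm (H w) \<le> norm w * K"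
    using bounded_linear.pos_bounded[OF assms] by blast
  have "\<bar>H w \<bullet> w\<bar> \<le> K * (norm w)\<^sup>2" for w
  proof -
    have "\<bar>H w \<bullet> w\<bar> \<le> norm (H w) * norm w"
      by (rule Cauchy_Schwarz_ineq2)
    also have "\<dots> \<le> (norm w * K) * norm w"
      using K(2) by (intro mult_right_mono) auto
    finally show ?thesis
      by (simp add: power2_eq_square algebra_simps)
  qed
  with K(1) show ?thesis
    using that by blast
qed

text \<open>
  In a ball of radius \<open>t\<close> that touches at \<open>y\<close>, the first-order gain \<open>G y \<bullet> w\<close> is at least
  \<open>norm (G y) / (2 * t) * (norm w)\<^sup>2\<close>, which beats the second-order terms once \<open>t\<close> is small.
\<close>

lemma small_tangent_ball_strict_min:
  fixes f :: "'a::real_inner \<Rightarrow> real"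
  assumes grad: "\<And>x. GDERIV f x :> G x" and hess: "(G has_derivative H) (at y)" and "G y \<noteq> 0"
  obtains t where "t > 0" "\<And>z. \<lbrakk>z \<in> cball (y + t *\<^sub>R sgn (G y)) t; z \<noteq> y\<rbrakk> \<Longrightarrow> f y < f z"
proof -
  define \<nu> where "\<nu> = sgn (G y)"
  have \<nu>: "norm \<nu> = 1"
    using \<open>G y \<noteq> 0\<close> by (simp add: \<nu>_def norm_sgn)
  have G: "G y \<bullet> w = norm (G y) * (\<nu> \<bullet> w)" for w
    using \<open>G y \<noteq> 0\<close> by (simp add: \<nu>_def sgn_div_norm)
  obtain K where K: "K > 0" "\<And>w. \<bar>H w \<bullet> w\<bar> \<le> K * (norm w)\<^sup>2"
    using quadratic_form_bound[OF has_derivative_bounded_linear[OF hess]] by blast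
  obtain d where d: "d > 0"
    "\<And>w. norm w < d \<Longrightarrow> \<bar>f (y + w) - f y - (G y \<bullet> w + H w \<bullet> w / 2)\<bar> \<le> 1 * (norm w)\<^sup>2"
    using second_order_Taylor[OF grad hess zero_less_one] by blast
  define t where "t = min (d / 4) (norm (G y) / (2 * (K + 1)))"
  have t: "t > 0" "2 * t < d"
    using d(1) K(1) \<open>G y \<noteq> 0\<close> by (auto simp: t_def)
  have tK: "2 * t * (K + 1) \<le> norm (G y)"
  proof -
    have "t \<le> norm (G y) / (2 * (K + 1))"
      by (simp add: t_def)
    then show ?thesis
      using K(1) by (simp add: field_simps)
  qed
  have "f y < f z" if z: "z \<in> cball (y + t *\<^sub>R \<nu>) t" "z \<noteq> y" for z
  proof -
    define w where "w = z - y"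
    have "w \<noteq> 0"
      using z by (simp add: w_def)
    have w: "(norm w)\<^sup>2 \<le> 2 * t * (\<nu> \<bullet> w)"
      using z(1) mem_tangent_ball_iff[OF \<nu>, of t z y] t by (simp add: w_def)
    have "\<nu> \<bullet> w \<le> norm w"
      using norm_cauchy_schwarz[of \<nu> w] \<nu> by simp
    then have "(norm w)\<^sup>2 \<le> 2 * t * norm w"
      using w t by (smt (verit) mult_left_mono)
    then have "norm w < d"
      using \<open>w \<noteq> 0\<close> t by (simp add: power2_eq_square)
    have "\<nu> \<bullet> w > 0"
      using w \<open>w \<noteq> 0\<close> t by (smt (verit) zero_less_mult_pos zero_less_power zero_less_norm_iff)
    have "(K / 2 + 1) * (norm w)\<^sup>2 < (K + 1) * (norm w)\<^sup>2"
      using K(1) \<open>w \<noteq> 0\<close> by simp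
    also have "\<dots> \<le> (K + 1) * (2 * t * (\<nu> \<bullet> w))"
      using w K(1) by (intro mult_left_mono) auto
    also have "\<dots> = (2 * t * (K + 1)) * (\<nu> \<bullet> w)"
      by simp
    also have "\<dots> \<le> G y \<bullet> w"
      unfolding G using tK \<open>\<nu> \<bullet> w > 0\<close> by (intro mult_right_mono) auto
    finally have "0 < G y \<bullet> w - (K / 2 + 1) * (norm w)\<^sup>2" by simp
    moreover have "f (y + w) - f y \<ge> G y \<bullet> w - (K / 2 + 1) * (norm w)\<^sup>2"
      using d(2)[OF \<open>norm w < d\<close>] K(2)[of w] by (simp add: algebra_simps abs_le_iff)
    ultimately show ?thesis
      by (simp add: w_def)
  qed
  with t(1) show ?thesis
    using that by (simp add: \<nu>_def)
qed

text \<open>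
  A tangent vector \<open>h\<close> does not point into the ball, so \<open>y\<close> is tested against the parabola
  \<open>y + s *\<^sub>R h + (a * s\<^sup>2) *\<^sub>R \<nu>\<close>, which stays in the ball for small \<open>s\<close> if \<open>a\<close> exceeds
  \<open>(norm h)\<^sup>2 / (2 * t)\<close>. Along it \<open>f\<close> changes by \<open>s\<^sup>2 * (norm (G y) * a + H h \<bullet> h / 2)\<close> to leading
  order, and \<open>a\<close> can be taken arbitrarily close to the bound.
\<close>

lemma tangential_second_order_condition:
  fixes f :: "'a::real_inner \<Rightarrow> real"
  assumes grad: "\<And>x. GDERIV f x :> G x" and hess: "(G has_derivative H) (at y)" and "G y \<noteq> 0"
    and "t > 0" and min: "\<And>z. z \<in> cball (y + t *\<^sub>R sgn (G y)) t \<Longrightarrow> f y \<le> f z"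
    and h: "G y \<bullet> h = 0"
  shows "0 \<le> H h \<bullet> h + norm (G y) / t * (norm h)\<^sup>2"
proof (rule ccontr)
  assume neg: "\<not> ?thesis"
  define \<nu> where "\<nu> = sgn (G y)"
  have \<nu>: "norm \<nu> = 1" "\<nu> \<bullet> \<nu> = 1"
    using \<open>G y \<noteq> 0\<close> by (simp_all add: \<nu>_def norm_sgn flip: power2_norm_eq_inner)
  have G: "G y \<bullet> w = norm (G y) * (\<nu> \<bullet> w)" for w
    using \<open>G y \<noteq> 0\<close> by (simp add: \<nu>_def sgn_div_norm)
  have "\<nu> \<bullet> h = 0"
    using h G \<open>G y \<noteq> 0\<close> by simp
  have blin: "bounded_linear H"
    using hess by (rule has_derivative_bounded_linear)
  have "(norm h)\<^sup>2 / (2 * t) < - (H h \<bullet> h) / (2 * norm (G y))"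
    using neg \<open>t > 0\<close> \<open>G y \<noteq> 0\<close> by (simp add: field_simps)
  then obtain a where a: "(norm h)\<^sup>2 / (2 * t) < a" "a < - (H h \<bullet> h) / (2 * norm (G y))"
    using dense by blast
  \<comment> \<open>\<open>- m\<close> is the leading coefficient along the parabola; \<open>e\<close> keeps the Taylor error below it.\<close>
  define m where "m = - (norm (G y) * a + H h \<bullet> h / 2)"
  have "m > 0"
    using a(2) \<open>G y \<noteq> 0\<close> by (simp add: m_def field_simps)
  define D where "D = (norm h)\<^sup>2 + 1"
  have D: "D > 0" "(norm h)\<^sup>2 < D"
    by (simp_all add: D_def add_nonneg_pos)
  define e where "e = m / D"
  have "e > 0"
    using \<open>m > 0\<close> D by (simp add: e_def)
  have e: "e * (norm h)\<^sup>2 < m"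
    using mult_strict_left_mono[OF D(2) \<open>e > 0\<close>] D(1) by (simp add: e_def)
  obtain d where d: "d > 0"
    "\<And>w. norm w < d \<Longrightarrow> \<bar>f (y + w) - f y - (G y \<bullet> w + H w \<bullet> w / 2)\<bar> \<le> e * (norm w)\<^sup>2"
    using second_order_Taylor[OF grad hess \<open>e > 0\<close>] by blast
  \<comment> \<open>The parabola is \<open>y + s *\<^sub>R u s\<close>, so that \<open>s\<^sup>2\<close> factors out of all second-order terms.\<close>
  define u where "u s = h + s *\<^sub>R (a *\<^sub>R \<nu>)" for s
  have u: "(u \<longlongrightarrow> h) (at_right 0)"
    unfolding u_def by (auto intro!: tendsto_eq_intros)
  have "((\<lambda>s. (norm (u s))\<^sup>2) \<longlongrightarrow> (norm h)\<^sup>2) (at_right 0)"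
    using u by (intro tendsto_intros)
  moreover have "(norm h)\<^sup>2 < 2 * t * a"
    using a(1) \<open>t > 0\<close> by (simp add: field_simps)
  ultimately have ev1: "eventually (\<lambda>s. (norm (u s))\<^sup>2 < 2 * t * a) (at_right 0)"
    by (rule order_tendstoD)
  have "((\<lambda>s. norm (s *\<^sub>R u s)) \<longlongrightarrow> norm (0 *\<^sub>R h)) (at_right 0)"
    using u by (intro tendsto_intros)
  then have ev2: "eventually (\<lambda>s. norm (s *\<^sub>R u s) < d) (at_right 0)"
    using d(1) by (intro order_tendstoD(2)) auto
  have "((\<lambda>s. norm (G y) * a + H (u s) \<bullet> u s / 2 + e * (norm (u s))\<^sup>2)
      \<longlongrightarrow> norm (G y) * a + H h \<bullet> h / 2 + e * (norm h)\<^sup>2) (at_right 0)"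
    using u bounded_linear.tendsto[OF blin u] by (intro tendsto_intros) auto
  then have ev3: "eventually (\<lambda>s. norm (G y) * a + H (u s) \<bullet> u s / 2 + e * (norm (u s))\<^sup>2 < 0) (at_right 0)"
    using e by (intro order_tendstoD(2)) (auto simp: m_def)
  obtain s where s: "s > 0" "(norm (u s))\<^sup>2 < 2 * t * a" "norm (s *\<^sub>R u s) < d"
    "norm (G y) * a + H (u s) \<bullet> u s / 2 + e * (norm (u s))\<^sup>2 < 0"
    using eventually_happens[OF eventually_conj[OF eventually_at_right_less[of 0]
          eventually_conj[OF ev1 eventually_conj[OF ev2 ev3]]]]
    by auto
  define w where "w = s *\<^sub>R u s"
  have \<nu>w: "\<nu> \<bullet> w = s\<^sup>2 * a"
    using \<nu> \<open>\<nu> \<bullet> h = 0\<close> by (simp add: w_def u_def inner_add_right power2_eq_square)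
  have "(norm w)\<^sup>2 = s\<^sup>2 * (norm (u s))\<^sup>2"
    by (simp add: w_def power_mult_distrib)
  also have "\<dots> \<le> s\<^sup>2 * (2 * t * a)"
    using s(2) by (intro mult_left_mono) auto
  finally have "(norm w)\<^sup>2 \<le> 2 * t * (\<nu> \<bullet> w)"
    by (simp add: \<nu>w algebra_simps)
  then have "f y \<le> f (y + w)"
    using min[of "y + w"] mem_tangent_ball_iff[OF \<nu>(1), of t "y + w" y] \<open>t > 0\<close>
    by (simp add: \<nu>_def)
  also have "\<dots> \<le> f y + (G y \<bullet> w + H w \<bullet> w / 2) + e * (norm w)\<^sup>2"
    using d(2)[of w] s(3) by (simp add: w_def abs_le_iff)
  also have "\<dots> = f y + s\<^sup>2 * (norm (G y) * a + H (u s) \<bullet> u s / 2 + e * (norm (u s))\<^sup>2)"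
    unfolding G \<nu>w using linear_cmul[OF bounded_linear.linear[OF blin]]
    by (simp add: w_def power_mult_distrib algebra_simps power2_eq_square)
  also have "\<dots> < f y"
    using s(1,4) by (simp add: mult_pos_neg)
  finally show False by simp
qed

text \<open>
  Points of a ball close to \<open>cball x t\<close> with a value of \<open>f\<close> close to the minimum must be close to a
  strict minimizer. The maximum of \<open>dist x z - t\<close> and \<open>f z - f y\<close> is positive at every \<open>z\<close> other
  than \<open>y\<close>, hence bounded below on the compact set of those \<open>z\<close> that are not close to \<open>y\<close>; the
  bound is the amount of perturbation allowed.
\<close>

lemma strict_min_stable:
  fixes f :: "'a::heine_borel \<Rightarrow> real"
  assumes cont: "continuous_on UNIV f" and "e > 0"
    and min: "\<And>z. \<lbrakk>z \<in> cball x t; z \<noteq> y\<rbrakk> \<Longrightarrow> f y < f z"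
  obtains d where "d > 0"
    "\<And>x' t' z. \<lbrakk>dist x' x < d; \<bar>t' - t\<bar> < d; z \<in> cball x' t'; f z < f y + d\<rbrakk> \<Longrightarrow> dist z y < e"
proof -
  define K where "K = cball x (t + 1) - ball y e"
  define m where "m z = max (dist x z - t) (f z - f y)" for z
  have "compact K"
    by (simp add: K_def compact_diff)
  have pos: "m z > 0" if "z \<in> K" for z
  proof (cases "dist x z \<le> t")
    case True
    have "z \<noteq> y"
      using that \<open>e > 0\<close> by (auto simp: K_def)
    then have "f y < f z"
      using True min by simp
    then show ?thesis
      by (simp add: m_def less_max_iff_disj)
  qed (simp add: m_def less_max_iff_disj)
  have "continuous_on K m"
    unfolding m_def by (intro continuous_intros continuous_on_subset[OF cont]) auto
  obtain c where c: "c > 0" "\<And>z. z \<in> K \<Longrightarrow> c \<le> m z"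
  proof (cases "K = {}")
    case True
    then show ?thesis using that[of 1] by simp
  next
    case False
    then show ?thesis
      using that continuous_attains_inf[OF \<open>compact K\<close> False \<open>continuous_on K m\<close>] pos by blast
  qed
  define d where "d = min (1 / 2) (c / 2)"
  have d: "d > 0" "2 * d \<le> 1" "2 * d \<le> c"
    using c(1) by (auto simp: d_def)
  have "dist z y < e" if "dist x' x < d" "\<bar>t' - t\<bar> < d" "z \<in> cball x' t'" "f z < f y + d" for x' t' z
  proof (rule ccontr)
    assume "\<not> dist z y < e"
    have *: "dist x z < t + 2 * d"
      using dist_triangle[of x z x'] that by (simp add: dist_commute abs_less_iff)
    then have "z \<in> K"
      using \<open>\<not> dist z y < e\<close> d by (simp add: K_def dist_commute)
    then have "c \<le> m z"
      by (rule c(2))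
    moreover have "m z < c"
      using * that(4) d by (simp add: m_def)
    ultimately show False by simp
  qed
  with d(1) show ?thesis
    using that by blast
qed

text \<open>
  By stability, a competitor \<open>z\<close> in a slightly larger ball lies near \<open>y\<close>, so only directions of
  \<open>w = z - y\<close> matter. The positive function \<open>q\<close> below has a positive minimum \<open>m\<close> on the unit sphere.
  Hence each direction either has a normal component of at least \<open>m\<close>, and the first-order term
  dominates, or gives the quadratic form a value of at least \<open>m\<close>, which survives a small increase
  of the radius.
\<close>

lemma strict_min_persists:
  fixes f :: "'a::euclidean_space \<Rightarrow> real"
  assumes grad: "\<And>x. GDERIV f x :> G x" and hess: "(G has_derivative H) (at y)" and "G y \<noteq> 0"
    and "t > 0"
    and min: "\<And>z. \<lbrakk>z \<in> cball (y + t *\<^sub>R sgn (G y)) t; z \<noteq> y\<rbrakk> \<Longrightarrow> f y < f z"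
    and posdef: "\<And>h. \<lbrakk>G y \<bullet> h = 0; h \<noteq> 0\<rbrakk> \<Longrightarrow> 0 < H h \<bullet> h + norm (G y) / t * (norm h)\<^sup>2"
  obtains s where "s > t" "\<And>z. \<lbrakk>z \<in> cball (y + s *\<^sub>R sgn (G y)) s; z \<noteq> y\<rbrakk> \<Longrightarrow> f y < f z"
proof -
  define \<nu> where "\<nu> = sgn (G y)"
  have \<nu>: "norm \<nu> = 1"
    using \<open>G y \<noteq> 0\<close> by (simp add: \<nu>_def norm_sgn)
  have G: "G y \<bullet> w = norm (G y) * (\<nu> \<bullet> w)" for w
    using \<open>G y \<noteq> 0\<close> by (simp add: \<nu>_def sgn_div_norm)
  define p where "p = norm (G y)"
  have "p > 0"
    using \<open>G y \<noteq> 0\<close> by (simp add: p_def)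
  have blin: "bounded_linear H"
    using hess by (rule has_derivative_bounded_linear)
  note lin = bounded_linear.linear[OF blin]
  have contf: "continuous_on UNIV f"
    using grad by (rule continuous_on_of_GDERIV)
  define q where "q w = max \<bar>\<nu> \<bullet> w\<bar> (H w \<bullet> w + p / t * (norm w)\<^sup>2)" for w
  obtain m where m: "m > 0" "\<And>w. norm w = 1 \<Longrightarrow> m \<le> q w"
  proof -
    have "continuous_on (sphere 0 1) q"
      unfolding q_def
      by (intro continuous_intros bounded_linear.continuous_on[OF blin])
    moreover have "\<nu> \<in> sphere 0 1"
      using \<nu> by simp
    ultimately obtain w where w: "norm w = 1" "\<And>v. norm v = 1 \<Longrightarrow> q w \<le> q v"
      using continuous_attains_inf[of "sphere 0 1" q] by fastforce
    have "q w > 0"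
    proof (cases "\<nu> \<bullet> w = 0")
      case True
      then show ?thesis
        using posdef[of w] w(1) G[of w] norm_zero by (fastforce simp: q_def p_def less_max_iff_disj)
    qed (auto simp: q_def less_max_iff_disj)
    then show ?thesis
      using that w(2) by blast
  qed
  obtain K where K: "K > 0" "\<And>w. \<bar>H w \<bullet> w\<bar> \<le> K * (norm w)\<^sup>2"
    using quadratic_form_bound[OF blin] by blast
  define e where "e = m / 8"
  have "e > 0"
    using m(1) by (simp add: e_def)
  obtain d where d: "d > 0"
    "\<And>w. norm w < d \<Longrightarrow> \<bar>f (y + w) - f y - (G y \<bullet> w + H w \<bullet> w / 2)\<bar> \<le> e * (norm w)\<^sup>2"
    using second_order_Taylor[OF grad hess \<open>e > 0\<close>] by blast
  \<comment> \<open>Within distance \<open>d'\<close> the Taylor formula holds, and a normal component of at least \<open>m\<close> wins.\<close>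
  define d' where "d' = min d (p * m / (K / 2 + e))"
  have "d' > 0"
    using d(1) \<open>p > 0\<close> m(1) K(1) \<open>e > 0\<close> by (auto simp: d'_def)
  obtain r where r: "r > 0"
    "\<And>x' t' z. \<lbrakk>dist x' (y + t *\<^sub>R \<nu>) < r; \<bar>t' - t\<bar> < r; z \<in> cball x' t'; f z < f y + r\<rbrakk> \<Longrightarrow> dist z y < d'"
    using strict_min_stable[OF contf \<open>d' > 0\<close> min] unfolding \<nu>_def by blast
  have "((\<lambda>s. p / t - p / s) \<longlongrightarrow> p / t - p / t) (at_right t)"
    using \<open>t > 0\<close> by (intro tendsto_intros) auto
  then have "eventually (\<lambda>s. p / t - p / s < m / 4) (at_right t)"
    using m(1) by (intro order_tendstoD(2)) auto
  moreover have "eventually (\<lambda>s. s \<in> {t<..<t + r}) (at_right t)"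
    using r(1) by (intro eventually_at_right_real) auto
  ultimately obtain s where s: "p / t - p / s < m / 4" "t < s" "s < t + r"
    using eventually_happens'[OF trivial_limit_at_right_real eventually_conj] by fastforce
  have "s > 0"
    using s \<open>t > 0\<close> by simp
  have "f y < f z" if z: "z \<in> cball (y + s *\<^sub>R \<nu>) s" "z \<noteq> y" for z
  proof (rule ccontr)
    assume "\<not> f y < f z"
    moreover have "dist (y + s *\<^sub>R \<nu>) (y + t *\<^sub>R \<nu>) < r"
      using s \<nu> by (simp add: dist_norm flip: scaleR_left_diff_distrib)
    ultimately have "dist z y < d'"
      using r s z(1) by (intro r(2)[of "y + s *\<^sub>R \<nu>" s]) auto
    define w where "w = z - y"
    have "w \<noteq> 0" "norm w < d" and wd: "norm w < p * m / (K / 2 + e)"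
      using z(2) \<open>dist z y < d'\<close> by (auto simp: w_def dist_norm d'_def)
    have w: "(norm w)\<^sup>2 \<le> 2 * s * (\<nu> \<bullet> w)"
      using z(1) mem_tangent_ball_iff[OF \<nu>, of s z y] \<open>s > 0\<close> by (simp add: w_def)
    then have \<nu>w: "(norm w)\<^sup>2 / (2 * s) \<le> \<nu> \<bullet> w"
      using \<open>s > 0\<close> by (simp add: field_simps)
    have Tay: "f z - f y \<ge> p * (\<nu> \<bullet> w) + H w \<bullet> w / 2 - e * (norm w)\<^sup>2"
      using d(2)[OF \<open>norm w < d\<close>] unfolding G by (simp add: w_def p_def abs_le_iff)
    define v where "v = w /\<^sub>R norm w"
    have v: "norm v = 1" "w = norm w *\<^sub>R v"
      using \<open>w \<noteq> 0\<close> by (simp_all add: v_def)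
    have "0 < f z - f y"
    proof (cases "\<bar>\<nu> \<bullet> v\<bar> \<ge> m")
      case True
      have "\<nu> \<bullet> w \<ge> 0"
        using \<nu>w \<open>s > 0\<close> by (meson divide_nonneg_pos mult_pos_pos order_trans zero_le_power2 zero_less_numeral)
      then have "\<nu> \<bullet> w = norm w * \<bar>\<nu> \<bullet> v\<bar>"
        by (metis abs_mult abs_norm_cancel abs_of_nonneg inner_scaleR_right v(2))
      then have "p * (\<nu> \<bullet> w) \<ge> p * (norm w * m)"
        using True \<open>p > 0\<close> by (simp add: mult_left_mono)
      moreover have "(K / 2 + e) * (norm w)\<^sup>2 < p * (norm w * m)"
      proof -
        have "norm w * (K / 2 + e) < p * m"
          using wd K(1) \<open>e > 0\<close> by (simp add: pos_less_divide_eq)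
        then have "norm w * (norm w * (K / 2 + e)) < norm w * (p * m)"
          using \<open>w \<noteq> 0\<close> by simp
        then show ?thesis
          by (simp add: power2_eq_square mult_ac)
      qed
      moreover have "H w \<bullet> w \<ge> - (K * (norm w)\<^sup>2)"
        using K(2)[of w] by linarith
      ultimately show ?thesis
        using Tay by (simp add: algebra_simps)
    next
      case False
      then have "m \<le> H v \<bullet> v + p / t"
        using m(2)[OF v(1)] v(1) by (auto simp: q_def)
      moreover have "p * (\<nu> \<bullet> w) \<ge> p * ((norm w)\<^sup>2 / (2 * s))"
        using \<nu>w \<open>p > 0\<close> by (intro mult_left_mono) auto
      moreover have "H w \<bullet> w = (norm w)\<^sup>2 * (H v \<bullet> v)"
        by (subst (1 2) v(2)) (simp add: linear_cmul[OF lin] power2_eq_square)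
      moreover have "(norm w)\<^sup>2 / 2 * (p / s + H v \<bullet> v - 2 * e)
          = p * ((norm w)\<^sup>2 / (2 * s)) + (norm w)\<^sup>2 * (H v \<bullet> v) / 2 - e * (norm w)\<^sup>2"
        by (simp add: algebra_simps)
      ultimately have "f z - f y \<ge> (norm w)\<^sup>2 / 2 * (p / s + H v \<bullet> v - 2 * e)"
        using Tay by linarith
      moreover have "p / s + H v \<bullet> v - 2 * e > 0"
      proof -
        have "0 < b + c - 2 * e" if "a - b < m / 4" "m \<le> c + a" for a b c
          using that m(1) by (simp add: e_def)
        then show ?thesis
          using s(1) \<open>m \<le> H v \<bullet> v + p / t\<close> by blast
      qed
      moreover have "(norm w)\<^sup>2 / 2 > 0"
        using \<open>w \<noteq> 0\<close> by simp
      ultimately show ?thesis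
        by (meson mult_pos_pos order_less_le_trans)
    qed
    with \<open>\<not> f y < f z\<close> show False by simp
  qed
  with s(2) show ?thesis
    using that by (simp add: \<nu>_def)
qed

section \<open>Differentiability of the Hopf-Lax function and uniqueness of the minimizer\<close>

lemma minimizer_iff:
  assumes "continuous_on UNIV g"
  shows "minimizer g y x t \<longleftrightarrow> y \<in> cball x t \<and> (\<forall>z\<in>cball x t. g y \<le> g z)"
proof (cases "0 \<le> t")
  case True
  obtain y0 where y0: "y0 \<in> cball x t" "hopf_lax g x t = g y0" "\<forall>z\<in>cball x t. g y0 \<le> g z"
    using hopf_lax_attained[OF assms True] by blast
  then show ?thesis
    by (auto simp: minimizer_def dist_norm norm_minus_commute intro: antisym)
next
  case False
  then have "cball x t = {}" "\<not> norm (y - x) \<le> t"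
    using norm_ge_zero[of "y - x"] by (auto simp del: norm_ge_zero)
  then show ?thesis
    by (simp add: minimizer_def)
qed

lemma unique_minimizer_iff:
  assumes "continuous_on UNIV g"
  shows "unique_minimizer g y x t \<longleftrightarrow> y \<in> cball x t \<and> (\<forall>z\<in>cball x t. z \<noteq> y \<longrightarrow> g y < g z)"
proof
  assume u: "unique_minimizer g y x t"
  then have y: "y \<in> cball x t" "\<And>w. w \<in> cball x t \<Longrightarrow> g y \<le> g w"
    by (auto simp: unique_minimizer_def minimizer_iff[OF assms])
  have "g y < g z" if z: "z \<in> cball x t" "z \<noteq> y" for z
  proof (rule ccontr)
    assume "\<not> g y < g z"
    then have "minimizer g z x t"
      using z(1) y(2) by (force simp: minimizer_iff[OF assms])
    with u z(2) show False
      unfolding unique_minimizer_def by blast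
  qed
  with y(1) show "y \<in> cball x t \<and> (\<forall>z\<in>cball x t. z \<noteq> y \<longrightarrow> g y < g z)"
    by blast
next
  assume y: "y \<in> cball x t \<and> (\<forall>z\<in>cball x t. z \<noteq> y \<longrightarrow> g y < g z)"
  then have "minimizer g y x t"
    unfolding minimizer_iff[OF assms] by (metis less_imp_le order_refl)
  moreover have "z = y" if "minimizer g z x t" for z
  proof (rule ccontr)
    assume "z \<noteq> y"
    then have "g y < g z" "g z \<le> g y"
      using y that by (simp_all add: minimizer_iff[OF assms])
    then show False by simp
  qed
  ultimately show "unique_minimizer g y x t"
    unfolding unique_minimizer_def by blast
qed

text \<open>
  Points of \<open>cball x t\<close> are written as \<open>x + t *\<^sub>R e\<close> with \<open>norm e \<le> 1\<close>, so that the constraint on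
  \<open>e\<close> does not depend on \<open>(x, t)\<close>. The derivative is that of \<open>g (x + t *\<^sub>R e)\<close> in \<open>(x, t)\<close> for the
  fixed \<open>e\<close> of the minimizer \<open>y\<close>. Using this \<open>e\<close> as competitor at \<open>(x', t')\<close> bounds the increment
  from above; using the optimal \<open>e'\<close> at \<open>(x', t')\<close> as competitor at \<open>(x, t)\<close> bounds it from below,
  and \<open>e'\<close> is close to \<open>e\<close> by stability of the minimizer.
\<close>

lemma hopf_lax_differentiable_if_unique:
  fixes g :: "real ^ 'n \<Rightarrow> real"
  assumes grad: "\<And>x. GDERIV g x :> G x" and contG: "isCont G y" and "t > 0"
    and uniq: "unique_minimizer g y x t"
  shows "(\<lambda>(x, t). hopf_lax g x t) differentiable (at (x, t))"
proof -
  have contg: "continuous_on UNIV g"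
    using grad by (rule continuous_on_of_GDERIV)
  have y: "y \<in> cball x t" and ymin: "\<And>z. \<lbrakk>z \<in> cball x t; z \<noteq> y\<rbrakk> \<Longrightarrow> g y < g z"
    and uy: "hopf_lax g x t = g y"
    using uniq unique_minimizer_iff[OF contg] by (auto simp: unique_minimizer_def minimizer_def)
  have ymin': "g y \<le> g z" if "z \<in> cball x t" for z
    using ymin[of z] that by (cases "z = y") auto
  define e where "e = (y - x) /\<^sub>R t"
  have e: "y = x + t *\<^sub>R e" "norm e \<le> 1"
    using y \<open>t > 0\<close> by (simp_all add: e_def dist_norm norm_minus_commute divide_simps)
  define L where "L q = G y \<bullet> (fst q + snd q *\<^sub>R e)" for q :: "(real ^ 'n) \<times> real"
  have "bounded_linear L"
    unfolding L_def
    by (intro bounded_linear_inner_right_comp bounded_linear_add bounded_linear_fst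
        bounded_linear_scaleR_const bounded_linear_snd)
  moreover have "\<exists>d>0. \<forall>q. norm (q - (x, t)) < d \<longrightarrow>
      norm ((\<lambda>(x, t). hopf_lax g x t) q - (\<lambda>(x, t). hopf_lax g x t) (x, t) - L (q - (x, t)))
        \<le> \<eta> * norm (q - (x, t))" if "\<eta> > 0" for \<eta>
  proof -
    have "\<eta> / 4 > 0"
      using that by simp
    then obtain d1 where d1: "d1 > 0"
      "\<And>a b. \<lbrakk>norm (a - y) < d1; norm (b - y) < d1\<rbrakk> \<Longrightarrow> \<bar>g a - g b - G y \<bullet> (a - b)\<bar> \<le> \<eta> / 4 * norm (a - b)"
      using strict_differentiability[OF grad contG] by metis
    define P where "P = norm (G y) + 1"
    have P: "norm (G y) \<le> P" "P > 0"
      by (simp_all add: P_def add_nonneg_pos)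
    \<comment> \<open>The constants make \<open>e'\<close> and \<open>e\<close> differ by at most \<open>3 * \<kappa> / t\<close>, see \<open>ee\<close> below; this
      costs \<open>\<eta> / 2\<close>, and the linearization of \<open>g\<close> costs the other half.\<close>
    define \<kappa> where "\<kappa> = min (d1 / 4) (min (t / 2) (\<eta> * t / (6 * P)))"
    have \<kappa>: "\<kappa> > 0" "3 * \<kappa> < d1" "\<kappa> < t"
      using d1(1) \<open>t > 0\<close> \<open>\<eta> > 0\<close> P by (auto simp: \<kappa>_def)
    have \<kappa>P: "P * (3 * \<kappa> / t) \<le> \<eta> / 2"
    proof -
      have "\<kappa> \<le> \<eta> * t / (6 * P)"
        by (simp add: \<kappa>_def)
      then show ?thesis
        using P \<open>t > 0\<close> by (simp add: field_simps)
    qed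
    obtain r where r: "r > 0"
      "\<And>x' t' z. \<lbrakk>dist x' x < r; \<bar>t' - t\<bar> < r; z \<in> cball x' t'; g z < g y + r\<rbrakk> \<Longrightarrow> dist z y < \<kappa>"
      using strict_min_stable[OF contg \<kappa>(1) ymin] by blast
    have "isCont g y"
      using contg by (simp add: continuous_on_eq_continuous_at)
    then obtain \<rho> where \<rho>: "\<rho> > 0" "\<And>z. norm (z - y) < \<rho> \<Longrightarrow> \<bar>g z - g y\<bar> < r"
      using r(1) unfolding continuous_at_eps_delta dist_norm by auto
    define d where "d = Min {\<rho> / 2, r, \<kappa>}"
    have d: "d > 0" "2 * d \<le> \<rho>" "d \<le> r" "d \<le> \<kappa>"
      using \<rho>(1) r(1) \<kappa>(1) by (auto simp: d_def)
    have "\<bar>hopf_lax g x' t' - hopf_lax g x t - L (x' - x, t' - t)\<bar> \<le> \<eta> * N"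
      if N: "N = norm (x' - x, t' - t)" "N < d" for x' t' N
    proof -
      have hN: "norm (x' - x) \<le> N" and \<tau>N: "\<bar>t' - t\<bar> \<le> N"
        using norm_fst_le[of "x' - x" "t' - t"] norm_snd_le[of "t' - t" "x' - x"] N by auto
      have "t' > 0"
        using \<tau>N N(2) d \<kappa> by linarith
      have step: "norm ((x' - x) + (t' - t) *\<^sub>R v) \<le> 2 * N" if "norm v \<le> 1" for v
      proof -
        have "norm ((x' - x) + (t' - t) *\<^sub>R v) \<le> norm (x' - x) + \<bar>t' - t\<bar> * norm v"
          by (metis norm_scaleR norm_triangle_ineq)
        also have "\<bar>t' - t\<bar> * norm v \<le> N * 1"
          using \<tau>N that by (intro mult_mono) auto
        finally show ?thesis
          using hN by simp
      qed
      obtain y' where y': "y' \<in> cball x' t'" "hopf_lax g x' t' = g y'" "\<And>z. z \<in> cball x' t' \<Longrightarrow> g y' \<le> g z"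
        using hopf_lax_attained[OF contg, of t' x'] \<open>t' > 0\<close> by auto
      define e' where "e' = (y' - x') /\<^sub>R t'"
      have e': "y' = x' + t' *\<^sub>R e'" "norm e' \<le> 1"
        using y'(1) \<open>t' > 0\<close> by (simp_all add: e'_def dist_norm norm_minus_commute divide_simps)
      \<comment> \<open>The competitor at \<open>(x', t')\<close>.\<close>
      define a where "a = x' + t' *\<^sub>R e"
      have a: "a - y = (x' - x) + (t' - t) *\<^sub>R e"
        by (simp add: a_def e(1) algebra_simps)
      have "a \<in> cball x' t'"
        using e(2) \<open>t' > 0\<close> by (simp add: a_def dist_norm mult_left_le)
      then have "g y' \<le> g a"
        by (rule y'(3))
      have na: "norm (a - y) \<le> 2 * N"
        unfolding a using e(2) by (rule step)
      then have "g a < g y + r"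
        using \<rho>(2)[of a] N(2) d by linarith
      then have "dist y' y < \<kappa>"
        using r(2)[OF _ _ y'(1)] \<open>g y' \<le> g a\<close> hN \<tau>N N(2) d by (simp add: dist_norm)
      have L: "L (x' - x, t' - t) = G y \<bullet> (a - y)"
        by (simp add: L_def a)
      have upper: "g y' - g y \<le> L (x' - x, t' - t) + \<eta> / 2 * N"
      proof -
        have "\<bar>g a - g y - G y \<bullet> (a - y)\<bar> \<le> \<eta> / 4 * norm (a - y)"
          using d1 na N(2) d \<kappa> by (intro d1(2)) auto
        also have "\<dots> \<le> \<eta> / 4 * (2 * N)"
          using na \<open>\<eta> > 0\<close> by (intro mult_left_mono) auto
        finally show ?thesis
          using \<open>g y' \<le> g a\<close> L by linarith
      qed
      \<comment> \<open>The competitor at \<open>(x, t)\<close>.\<close>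
      define b where "b = x + t *\<^sub>R e'"
      have "b \<in> cball x t"
        using e'(2) \<open>t > 0\<close> by (simp add: b_def dist_norm mult_left_le)
      then have "g y \<le> g b"
        by (rule ymin')
      have y'b: "y' - b = (x' - x) + (t' - t) *\<^sub>R e'"
        by (simp add: b_def e'(1) algebra_simps)
      have "b - y = (y' - y) - (y' - b)"
        by simp
      then have "norm (b - y) \<le> norm (y' - y) + norm (y' - b)"
        by (metis norm_triangle_ineq4)
      also have "norm (y' - b) \<le> 2 * N"
        unfolding y'b using e'(2) by (rule step)
      finally have nb: "norm (b - y) < 3 * \<kappa>"
        using \<open>dist y' y < \<kappa>\<close> N(2) d by (simp add: dist_norm)
      have "b - y = t *\<^sub>R (e' - e)"
        by (simp add: b_def e(1) algebra_simps)
      then have ee: "norm (e' - e) \<le> 3 * \<kappa> / t"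
        using nb \<open>t > 0\<close> by (simp only: norm_scaleR) (simp add: pos_le_divide_eq mult.commute)
      have lower: "g y' - g y \<ge> L (x' - x, t' - t) - \<eta> * N"
      proof -
        have "\<bar>g y' - g b - G y \<bullet> (y' - b)\<bar> \<le> \<eta> / 4 * norm (y' - b)"
          using nb \<open>dist y' y < \<kappa>\<close> \<kappa> by (intro d1(2)) (auto simp: dist_norm)
        also have "\<dots> \<le> \<eta> / 4 * (2 * N)"
          using \<open>norm (y' - b) \<le> 2 * N\<close> \<open>\<eta> > 0\<close> by (intro mult_left_mono) auto
        finally have 1: "g y' - g b \<ge> G y \<bullet> (y' - b) - \<eta> / 2 * N"
          by linarith
        have "y' - b = (a - y) + (t' - t) *\<^sub>R (e' - e)"
          unfolding y'b a by (simp add: algebra_simps)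
        define c where "c = (t' - t) * (G y \<bullet> (e' - e))"
        have 2: "G y \<bullet> (y' - b) = L (x' - x, t' - t) + c"
          unfolding L c_def \<open>y' - b = (a - y) + _\<close> by (simp only: inner_add_right inner_scaleR_right)
        have "\<bar>c\<bar> \<le> N * (P * (3 * \<kappa> / t))"
          unfolding c_def abs_mult
        proof (intro mult_mono \<tau>N)
          have "\<bar>G y \<bullet> (e' - e)\<bar> \<le> norm (G y) * norm (e' - e)"
            by (rule Cauchy_Schwarz_ineq2)
          also have "\<dots> \<le> P * (3 * \<kappa> / t)"
            using P ee by (intro mult_mono) auto
          finally show "\<bar>G y \<bullet> (e' - e)\<bar> \<le> P * (3 * \<kappa> / t)" .
        qed (use N in auto)
        also have "\<dots> \<le> N * (\<eta> / 2)"
          using \<kappa>P N(1) by (intro mult_left_mono) auto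
        also have "\<dots> = \<eta> / 2 * N"
          by (rule mult.commute)
        finally show ?thesis
          using 1 2 \<open>g y \<le> g b\<close> by linarith
      qed
      have "\<eta> * N \<ge> 0"
        using \<open>\<eta> > 0\<close> N(1) by simp
      then show ?thesis
        using upper lower by (simp add: uy y'(2) abs_le_iff)
    qed
    with d(1) show ?thesis
      by (intro exI[of _ d]) auto
  qed
  ultimately have "((\<lambda>(x, t). hopf_lax g x t) has_derivative L) (at (x, t))"
    unfolding has_derivative_at_alt by blast
  then show ?thesis
    by (rule differentiableI)
qed

text \<open>
  Translating the ball and the minimizer together by \<open>h\<close> gives
  \<open>hopf_lax g (x + h) t \<le> g (y + h)\<close>, with equality at \<open>h = 0\<close>; so the difference has a minimum there.
\<close>

lemma gradient_at_minimizer_eq: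
  fixes g :: "real ^ 'n \<Rightarrow> real"
  assumes grad: "\<And>x. GDERIV g x :> G x"
    and D: "((\<lambda>(x, t). hopf_lax g x t) has_derivative D) (at (x, t))"
    and y: "minimizer g y x t"
  shows "G y \<bullet> h = D (h, 0)"
proof -
  have contg: "continuous_on UNIV g"
    using grad by (rule continuous_on_of_GDERIV)
  have ty: "norm (y - x) \<le> t"
    using y by (simp add: minimizer_def)
  then have "t \<ge> 0"
    using norm_ge_zero order_trans by blast
  define \<phi> where "\<phi> h = g (y + h) - hopf_lax g (x + h) t" for h
  have "\<phi> 0 \<le> \<phi> h" for h
  proof -
    obtain z where z: "z \<in> cball (x + h) t" "hopf_lax g (x + h) t = g z"
        "\<forall>w\<in>cball (x + h) t. g z \<le> g w"
      using hopf_lax_attained[OF contg \<open>t \<ge> 0\<close>] by blast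
    moreover have "y + h \<in> cball (x + h) t"
      using ty by (simp add: dist_norm norm_minus_commute)
    ultimately show ?thesis
      using y by (simp add: \<phi>_def minimizer_def)
  qed
  moreover have "(\<phi> has_derivative (\<lambda>h. h \<bullet> G y - D (h, 0))) (at 0)"
  proof -
    have 1: "((\<lambda>h. y + h) has_derivative (\<lambda>h. h)) (at 0)"
      and 2: "((\<lambda>h. (x + h, t)) has_derivative (\<lambda>h. (h, 0))) (at 0)"
      by (auto intro!: derivative_eq_intros)
    have "((\<lambda>h. g (y + h)) has_derivative (\<lambda>h. h \<bullet> G y)) (at 0)"
      using has_derivative_compose[OF 1, of g "\<lambda>h. h \<bullet> G y"] grad[of y] by (simp add: gderiv_def)
    moreover have "((\<lambda>h. hopf_lax g (x + h) t) has_derivative (\<lambda>h. D (h, 0))) (at 0)"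
      using has_derivative_compose[OF 2, of "\<lambda>(x, t). hopf_lax g x t" D] D by simp
    ultimately show ?thesis
      unfolding \<phi>_def by (rule has_derivative_diff)
  qed
  ultimately have "(\<lambda>h. h \<bullet> G y - D (h, 0)) = (\<lambda>h. 0)"
    by (intro has_derivative_local_min[of \<phi> _ 0]) auto
  then show ?thesis
    by (metis (no_types, lifting) eq_iff_diff_eq_0 inner_commute)
qed

text \<open>
  All minimizers share the gradient \<open>G y \<noteq> 0\<close>, so \<open>x\<close> lies at distance \<open>t\<close> from each of them in the
  same direction.
\<close>

lemma unique_minimizer_if_hopf_lax_differentiable:
  fixes g :: "real ^ 'n \<Rightarrow> real"
  assumes grad: "\<And>x. GDERIV g x :> G x"
    and diff: "(\<lambda>(x, t). hopf_lax g x t) differentiable (at (x, t))"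
    and y: "minimizer g y x t" and "G y \<noteq> 0"
  shows "unique_minimizer g y x t"
proof -
  have contg: "continuous_on UNIV g"
    using grad by (rule continuous_on_of_GDERIV)
  obtain D where D: "((\<lambda>(x, t). hopf_lax g x t) has_derivative D) (at (x, t))"
    using diff by (auto simp: differentiable_def)
  have foot: "x = z + t *\<^sub>R sgn (G z)" if "minimizer g z x t" "G z \<noteq> 0" for z
    using that constrained_minimum_on_normal[OF grad, of z x t] minimizer_iff[OF contg] by blast
  have "z = y" if z: "minimizer g z x t" for z
  proof -
    have "G z = G y"
      using gradient_at_minimizer_eq[OF grad D z] gradient_at_minimizer_eq[OF grad D y]
      by (metis vector_eq_rdot)
    then show ?thesis
      using foot[OF z] foot[OF y \<open>G y \<noteq> 0\<close>] \<open>G y \<noteq> 0\<close> by (metis add_right_cancel)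
  qed
  with y show ?thesis
    unfolding unique_minimizer_def by blast
qed

section \<open>Kernel of the Jacobian matrix of the flow\<close>

lemma has_derivative_sgn:
  fixes x :: "'a::real_inner"
  assumes "x \<noteq> 0"
  shows "(sgn has_derivative (\<lambda>h. (1 / norm x) *\<^sub>R (h - (sgn x \<bullet> h) *\<^sub>R sgn x))) (at x)"
proof -
  have "(norm has_derivative (\<lambda>h. sgn x \<bullet> h)) (at x)"
    using has_derivative_norm[OF assms] by (simp add: inner_commute)
  moreover have "norm x \<noteq> 0"
    using assms by simp
  ultimately have "((\<lambda>x. x /\<^sub>R norm x) has_derivative
      (\<lambda>h. (1 / norm x) *\<^sub>R (h - (sgn x \<bullet> h) *\<^sub>R sgn x))) (at x)"
    by (auto intro!: derivative_eq_intros simp: sgn_div_norm divide_inverse scaleR_diff_right)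
  then show ?thesis
    by (simp add: sgn_div_norm[abs_def])
qed

text \<open>
  With \<open>c = norm (grad g y) / t\<close>, the map \<open>v \<mapsto> v + (1 / c) *\<^sub>R P (H v)\<close>, where \<open>P\<close> is the orthogonal
  projection along \<open>\<nu>\<close>, is the derivative of \<open>flow g _ t\<close> at \<open>y\<close>. A kernel vector equals
  \<open>- (1 / c) *\<^sub>R P (H v)\<close>, hence is tangential, and pairing the kernel equation with \<open>v\<close> gives the form.
\<close>

lemma sphere_flow_kernel_imp_null:
  fixes \<nu> v Hv :: "'a::real_inner"
  assumes "norm \<nu> = 1" "c > 0"
    and ker: "v + (1 / c) *\<^sub>R (Hv - (\<nu> \<bullet> Hv) *\<^sub>R \<nu>) = 0"
  shows "\<nu> \<bullet> v = 0" "Hv \<bullet> v + c * (norm v)\<^sup>2 = 0"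
proof -
  have \<nu>: "\<nu> \<bullet> \<nu> = 1"
    using assms(1) by (simp flip: power2_norm_eq_inner)
  have "c *\<^sub>R (v + (1 / c) *\<^sub>R (Hv - (\<nu> \<bullet> Hv) *\<^sub>R \<nu>)) = 0"
    by (simp only: ker scaleR_zero_right)
  then have k: "c *\<^sub>R v + (Hv - (\<nu> \<bullet> Hv) *\<^sub>R \<nu>) = 0"
    using \<open>c > 0\<close> by (simp add: scaleR_add_right)
  have "c * (\<nu> \<bullet> v) = \<nu> \<bullet> (c *\<^sub>R v + (Hv - (\<nu> \<bullet> Hv) *\<^sub>R \<nu>))"
    using \<nu> by (simp add: inner_add_right inner_diff_right)
  then show *: "\<nu> \<bullet> v = 0"
    unfolding k using \<open>c > 0\<close> by simp
  have "Hv \<bullet> v + c * (norm v)\<^sup>2 = (c *\<^sub>R v + (Hv - (\<nu> \<bullet> Hv) *\<^sub>R \<nu>)) \<bullet> v"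
    using * by (simp add: inner_add_left inner_diff_left power2_norm_eq_inner)
  then show "Hv \<bullet> v + c * (norm v)\<^sup>2 = 0"
    unfolding k by simp
qed

text \<open>
  A null vector of a positive semidefinite symmetric form is orthogonal, for that form, to every
  tangent vector. Applied to the tangent vector \<open>k = c *\<^sub>R v + P (H v)\<close>, where \<open>P\<close> is the orthogonal
  projection along \<open>\<nu>\<close>, the pairing is \<open>(norm k)\<^sup>2\<close>.
\<close>

lemma null_imp_sphere_flow_kernel:
  fixes H :: "'a::real_inner \<Rightarrow> 'a"
  assumes "norm \<nu> = 1" "c > 0" and lin: "linear H" and sym: "\<And>h k. H h \<bullet> k = H k \<bullet> h"
    and psd: "\<And>h. \<nu> \<bullet> h = 0 \<Longrightarrow> 0 \<le> H h \<bullet> h + c * (norm h)\<^sup>2"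
    and v: "\<nu> \<bullet> v = 0" "H v \<bullet> v + c * (norm v)\<^sup>2 \<le> 0"
  shows "v + (1 / c) *\<^sub>R (H v - (\<nu> \<bullet> H v) *\<^sub>R \<nu>) = 0"
proof -
  have \<nu>: "\<nu> \<bullet> \<nu> = 1"
    using assms(1) by (simp flip: power2_norm_eq_inner)
  define k where "k = c *\<^sub>R v + (H v - (\<nu> \<bullet> H v) *\<^sub>R \<nu>)"
  have \<nu>k: "\<nu> \<bullet> k = 0"
    using \<nu> v(1) by (simp add: k_def inner_add_right inner_diff_right)
  define B where "B = H v \<bullet> k + c * (v \<bullet> k)"
  have "B = (k + (\<nu> \<bullet> H v) *\<^sub>R \<nu>) \<bullet> k"
    by (simp add: B_def k_def inner_add_left)
  then have B: "B = (norm k)\<^sup>2"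
    using \<nu>k by (simp add: inner_add_left power2_norm_eq_inner)
  define q where "q = H k \<bullet> k + c * (norm k)\<^sup>2"
  have "q \<ge> 0"
    unfolding q_def using \<nu>k by (rule psd)
  \<comment> \<open>A small step from \<open>v\<close> against \<open>k\<close> makes the form negative unless \<open>B = 0\<close>.\<close>
  define \<epsilon> where "\<epsilon> = 1 / (q + 1)"
  have \<epsilon>: "\<epsilon> > 0" "\<epsilon> * q \<le> 1"
    using \<open>q \<ge> 0\<close> by (simp_all add: \<epsilon>_def)
  define u where "u = v - (\<epsilon> * B) *\<^sub>R k"
  have "0 \<le> H u \<bullet> u + c * (norm u)\<^sup>2"
    using v(1) \<nu>k by (intro psd) (simp add: u_def inner_diff_right)
  also have "\<dots> = (H v \<bullet> v + c * (norm v)\<^sup>2) - 2 * (\<epsilon> * B) * B + (\<epsilon> * B)\<^sup>2 * q"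
  proof -
    have "H (v - d *\<^sub>R k) \<bullet> (v - d *\<^sub>R k) + c * (norm (v - d *\<^sub>R k))\<^sup>2
        = (H v \<bullet> v + c * (norm v)\<^sup>2) - 2 * d * B + d\<^sup>2 * q" for d
      unfolding B_def q_def power2_norm_eq_inner
      using sym[of k v]
      by (simp add: linear_diff[OF lin] linear_cmul[OF lin] inner_diff_left inner_diff_right
          inner_commute[of k v] power2_eq_square algebra_simps)
    then show ?thesis
      by (simp only: u_def)
  qed
  also have "\<dots> \<le> - (\<epsilon> * B\<^sup>2)"
  proof -
    have "(\<epsilon> * B)\<^sup>2 * q = (\<epsilon> * B\<^sup>2) * (\<epsilon> * q)"
      by (simp add: power2_eq_square)
    also have "\<dots> \<le> (\<epsilon> * B\<^sup>2) * 1"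
      using \<epsilon> by (intro mult_left_mono) auto
    finally show ?thesis
      using v(2) by (simp add: power2_eq_square algebra_simps)
  qed
  finally have "\<epsilon> * B\<^sup>2 \<le> 0"
    by simp
  then have "B = 0"
    using \<epsilon>(1) by (simp add: mult_le_0_iff)
  then have "(1 / c) *\<^sub>R k = 0"
    using B by simp
  then show ?thesis
    using \<open>c > 0\<close> by (simp add: k_def scaleR_add_right)
qed

lemma flow_eq: "flow g y t = y + t *\<^sub>R sgn (grad g y)"
  by (simp add: flow_def sgn_div_norm divide_inverse)

lemma det_jacobian_flow_eq_0_iff:
  fixes g :: "real ^ 'n \<Rightarrow> real"
  assumes hess: "(grad g has_derivative H) (at y)" and "grad g y \<noteq> 0"
  shows "det (jacobian (\<lambda>z. flow g z t) (at y)) = 0 \<longleftrightarrow>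
    (\<exists>v. v \<noteq> 0 \<and> v + (t / norm (grad g y)) *\<^sub>R (H v - (sgn (grad g y) \<bullet> H v) *\<^sub>R sgn (grad g y)) = 0)"
    (is "_ \<longleftrightarrow> (\<exists>v. v \<noteq> 0 \<and> ?J v = 0)")
proof -
  have "((\<lambda>z. flow g z t) has_derivative ?J) (at y)"
  proof -
    have "((\<lambda>z. sgn (grad g z)) has_derivative
        (\<lambda>v. (1 / norm (grad g y)) *\<^sub>R (H v - (sgn (grad g y) \<bullet> H v) *\<^sub>R sgn (grad g y)))) (at y)"
      using has_derivative_compose[OF hess has_derivative_sgn[OF assms(2)]] by simp
    then have "((\<lambda>z. z + t *\<^sub>R sgn (grad g z)) has_derivative
        (\<lambda>v. v + t *\<^sub>R ((1 / norm (grad g y)) *\<^sub>R (H v - (sgn (grad g y) \<bullet> H v) *\<^sub>R sgn (grad g y))))) (at y)"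
      by (intro has_derivative_add has_derivative_ident has_derivative_scaleR_right)
    then show ?thesis
      by (simp add: flow_eq)
  qed
  then have "(\<lambda>v. jacobian (\<lambda>z. flow g z t) (at y) *v v) = ?J"
    using jacobian_works[THEN iffD1, OF differentiableI] has_derivative_unique by blast
  then have J: "jacobian (\<lambda>z. flow g z t) (at y) *v v = ?J v" for v
    by (rule fun_cong)
  let ?A = "jacobian (\<lambda>z. flow g z t) (at y)"
  have "det ?A = 0 \<longleftrightarrow> \<not> (\<forall>v. ?A *v v = 0 \<longrightarrow> v = 0)"
    by (metis invertible_det_nz invertible_left_inverse matrix_left_invertible_ker)
  then show ?thesis
    unfolding J by blast
qed

section \<open>Regular conjugate points\<close>

lemma Ck_2_gradient:
  fixes g :: "real ^ 'n \<Rightarrow> real"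
  assumes "k \<ge> 2" "Ck k g"
  shows "GDERIV g x :> grad g x" "grad g differentiable (at x)"
proof -
  obtain m where "k = Suc (Suc m)"
    using \<open>k \<ge> 2\<close> by (metis add_2_eq_Suc le_Suc_ex)
  then have 1: "\<And>x. g differentiable (at x)"
    and 2: "\<And>i x. (\<lambda>x. frechet_derivative g (at x) (axis i 1)) differentiable (at x)"
    using \<open>Ck k g\<close> by auto
  from 1 show "GDERIV g x :> grad g x"
    by (rule GDERIV_grad)
  have "(\<lambda>x. grad g x \<bullet> b) differentiable (at x)" if b: "b \<in> Basis" for b
  proof -
    obtain i where "b = axis i 1"
      using b by (auto simp: Basis_vec_def)
    then have "(\<lambda>x. grad g x \<bullet> b) = (\<lambda>x. frechet_derivative g (at x) (axis i 1))"
      by (simp add: grad_def inner_axis)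
    then show ?thesis
      using 2 by simp
  qed
  then show "grad g differentiable (at x)"
    by (subst differentiable_componentwise_within) auto
qed

text \<open>
  If some \<open>z\<close> in the ball at time \<open>t\<close> had a smaller value, then moving \<open>z\<close> slightly towards \<open>y\<close> would
  give such a point in the ball at a slightly earlier time, contradicting \<open>t \<le> t_s g y\<close>.
\<close>

lemma minimizer_flow_if_le_t_s:
  fixes g :: "real ^ 'n \<Rightarrow> real"
  assumes cont: "continuous_on UNIV g" and "grad g y \<noteq> 0" and "t > 0" and le: "ennreal t \<le> t_s g y"
  shows "minimizer g y (flow g y t) t"
proof (rule ccontr)
  assume not_min: "\<not> ?thesis"
  define \<nu> where "\<nu> = sgn (grad g y)"
  have \<nu>: "norm \<nu> = 1"
    using assms(2) by (simp add: \<nu>_def norm_sgn)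
  have "y \<in> cball (flow g y t) t"
    using \<nu> \<open>t > 0\<close> by (simp add: flow_eq dist_norm flip: \<nu>_def)
  then obtain z where z: "z \<in> cball (flow g y t) t" "g z < g y"
    using not_min minimizer_iff[OF cont] by (auto simp: not_le)
  \<comment> \<open>The homothety with centre \<open>y\<close> and ratio \<open>r\<close> maps the ball of radius \<open>t\<close> onto that of radius \<open>r * t\<close>.\<close>
  define z' where "z' r = y + r *\<^sub>R (z - y)" for r
  have "(z' \<longlongrightarrow> z' 1) (at_left 1)"
    unfolding z'_def by (intro tendsto_intros)
  then have "(z' \<longlongrightarrow> z) (at_left 1)"
    by (simp add: z'_def[of 1])
  moreover have "isCont g z"
    using cont by (simp add: continuous_on_eq_continuous_at)
  ultimately have "((\<lambda>r. g (z' r)) \<longlongrightarrow> g z) (at_left 1)"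
    by (intro isCont_tendsto_compose[of z g])
  then have "eventually (\<lambda>r. g (z' r) < g y) (at_left 1)"
    using z(2) by (rule order_tendstoD)
  moreover have "eventually (\<lambda>r. r \<in> {0<..<1}) (at_left (1::real))"
    by (rule eventually_at_left_real) simp
  ultimately have "eventually (\<lambda>r. g (z' r) < g y \<and> r \<in> {0<..<1}) (at_left 1)"
    by (rule eventually_conj)
  then obtain r where r: "0 < r" "r < 1" "g (z' r) < g y"
    using eventually_happens'[OF trivial_limit_at_left_real] by (metis (lifting) greaterThanLessThan_iff)
  have "(norm (z - y))\<^sup>2 \<le> 2 * t * (\<nu> \<bullet> (z - y))"
    using z(1) mem_tangent_ball_iff[OF \<nu>, of t z y] \<open>t > 0\<close> by (simp add: flow_eq flip: \<nu>_def)
  then have "r\<^sup>2 * (norm (z - y))\<^sup>2 \<le> r\<^sup>2 * (2 * t * (\<nu> \<bullet> (z - y)))"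
    by (intro mult_left_mono) auto
  then have "z' r \<in> cball (flow g y (r * t)) (r * t)"
    using mem_tangent_ball_iff[OF \<nu>, of "r * t" "z' r" y] \<open>t > 0\<close> r(1)
    by (simp add: flow_eq z'_def power_mult_distrib power2_eq_square mult_ac flip: \<nu>_def)
  then have "\<not> minimizer g y (flow g y (r * t)) (r * t)"
    using r(3) minimizer_iff[OF cont] by (meson not_le)
  then have "t_s g y \<le> ennreal (r * t)"
    unfolding t_s_def using r(1) \<open>t > 0\<close> by (intro INF_lower) auto
  also have "\<dots> < ennreal t"
    using r \<open>t > 0\<close> by (intro ennreal_lessI) auto
  finally show False
    using le by simp
qed

theorem corollary5p5:
  fixes g :: "real ^ 'n \<Rightarrow> real" and k :: nat
  assumes "k \<ge> 2" and "Ck k g"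
  shows "T1_set g = conjugate_set g - singular_set g"
proof -
  note grad = Ck_2_gradient(1)[OF assms]
  have contg: "continuous_on UNIV g"
    using grad by (rule continuous_on_of_GDERIV)
  have contG: "isCont (grad g) y" for y
    using Ck_2_gradient(2)[OF assms] by (rule differentiable_imp_continuous_within)
  define H where "H y = frechet_derivative (grad g) (at y)" for y
  have hess: "(grad g has_derivative H y) (at y)" for y
    unfolding H_def using Ck_2_gradient(2)[OF assms] frechet_derivative_works by blast
  note uniq_iff = unique_minimizer_iff[OF contg]
  note min_iff = minimizer_iff[OF contg]
  have foot: "y \<in> cball (flow g y t) t" if "grad g y \<noteq> 0" "t > 0" for y t
    using that by (simp add: flow_eq dist_norm norm_sgn)
  have nested: "cball (flow g y s) s \<subseteq> cball (flow g y t) t" if "grad g y \<noteq> 0" "0 \<le> s" "s \<le> t" for y s t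
    unfolding flow_eq using that by (intro tangent_balls_mono) (auto simp: norm_sgn)
  have t_bar_ge: "ennreal s \<le> t_bar g y"
    if "s > 0" "grad g y \<noteq> 0" "\<And>z. \<lbrakk>z \<in> cball (flow g y s) s; z \<noteq> y\<rbrakk> \<Longrightarrow> g y < g z" for y s
    unfolding t_bar_def using that foot uniq_iff by (intro SUP_upper) auto
  have psd: "0 \<le> H y h \<bullet> h + norm (grad g y) / t * (norm h)\<^sup>2"
    if "minimizer g y (flow g y t) t" "grad g y \<noteq> 0" "t > 0" "grad g y \<bullet> h = 0" for y t h
    using that min_iff tangential_second_order_condition[OF grad hess] unfolding flow_eq by metis
  show ?thesis
  proof (intro equalityI subsetI)
    fix p assume "p \<in> T1_set g"
    then obtain y t where p: "p = (flow g y t, t)" and y: "grad g y \<noteq> 0"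
      and t: "0 \<le> t" "t_bar g y \<le> ennreal t" "ennreal t \<le> t_s g y"
      and ex: "\<exists>y'. unique_minimizer g y' (flow g y t) t"
      by (auto simp: T1_set_def TM_set_def M_set_def)
    have "t > 0"
    proof -
      obtain s where "s > 0" "\<And>z. \<lbrakk>z \<in> cball (flow g y s) s; z \<noteq> y\<rbrakk> \<Longrightarrow> g y < g z"
        using small_tangent_ball_strict_min[OF grad hess y] unfolding flow_eq by blast
      with y t_bar_ge have "ennreal s \<le> ennreal t"
        using t(2) order_trans by blast
      then show ?thesis
        using \<open>s > 0\<close> t(1) by (simp add: ennreal_le_iff)
    qed
    have min: "minimizer g y (flow g y t) t"
      using contg y \<open>t > 0\<close> t(3) by (rule minimizer_flow_if_le_t_s)
    then have uniq: "unique_minimizer g y (flow g y t) t"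
      using ex by (auto simp: unique_minimizer_def)
    \<comment> \<open>Otherwise \<open>y\<close> would remain the unique minimizer beyond the time \<open>t\<close>, against \<open>t_bar g y \<le> t\<close>.\<close>
    have "det (jacobian (\<lambda>z. flow g z t) (at y)) = 0"
    proof (rule ccontr)
      assume nz: "det (jacobian (\<lambda>z. flow g z t) (at y)) \<noteq> 0"
      have posdef: "0 < H y h \<bullet> h + norm (grad g y) / t * (norm h)\<^sup>2"
        if h: "grad g y \<bullet> h = 0" "h \<noteq> 0" for h
      proof (rule ccontr)
        assume "\<not> ?thesis"
        then have "h + (1 / (norm (grad g y) / t)) *\<^sub>R (H y h - (sgn (grad g y) \<bullet> H y h) *\<^sub>R sgn (grad g y)) = 0"
          using h y \<open>t > 0\<close> psd[OF min y \<open>t > 0\<close>]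
          by (intro null_imp_sphere_flow_kernel has_derivative_linear[OF hess] hessian_symmetric[OF grad hess])
            (auto simp: norm_sgn sgn_div_norm)
        then show False
          using nz h(2) det_jacobian_flow_eq_0_iff[OF hess y, of t] by auto
      qed
      obtain s where s: "s > t" "\<And>z. \<lbrakk>z \<in> cball (flow g y s) s; z \<noteq> y\<rbrakk> \<Longrightarrow> g y < g z"
        using strict_min_persists[OF grad hess y \<open>t > 0\<close> _ posdef] uniq
        unfolding uniq_iff flow_eq by metis
      then have "ennreal s \<le> ennreal t"
        using t_bar_ge[of s y] y \<open>t > 0\<close> t(2) by (meson order_trans less_trans)
      then show False
        using s(1) \<open>t > 0\<close> by (simp add: ennreal_le_iff)
    qed
    moreover have "(\<lambda>(x, t). hopf_lax g x t) differentiable (at (flow g y t, t))"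
      using grad contG \<open>t > 0\<close> uniq by (rule hopf_lax_differentiable_if_unique)
    ultimately show "p \<in> conjugate_set g - singular_set g"
      using p y \<open>t > 0\<close> min by (auto simp: conjugate_set_def singular_set_def)
  next
    fix p assume "p \<in> conjugate_set g - singular_set g"
    then obtain y t where p: "p = (flow g y t, t)" and y: "grad g y \<noteq> 0" and "t > 0"
      and min: "minimizer g y (flow g y t) t"
      and det: "det (jacobian (\<lambda>z. flow g z t) (at y)) = 0"
      and diff: "(\<lambda>(x, t). hopf_lax g x t) differentiable (at (flow g y t, t))"
      by (auto simp: conjugate_set_def singular_set_def)
    have uniq: "unique_minimizer g y (flow g y t) t"
      using grad diff min y by (rule unique_minimizer_if_hopf_lax_differentiable)
    have le_t_s: "ennreal t \<le> t_s g y"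
      unfolding t_s_def
    proof (rule INF_greatest)
      fix s assume "s \<in> {s. 0 < s \<and> \<not> minimizer g y (flow g y s) s}"
      then have s: "s > 0" "\<not> minimizer g y (flow g y s) s"
        by auto
      have "\<not> s \<le> t"
        using s min foot[OF y \<open>s > 0\<close>] nested[OF y, of s t] unfolding min_iff by (meson less_imp_le subsetD)
      then show "ennreal t \<le> ennreal s"
        by (intro ennreal_leI) simp
    qed
    have t_bar_le: "t_bar g y \<le> ennreal t"
      unfolding t_bar_def
    proof (rule SUP_least)
      fix s assume "s \<in> {s. 0 < s \<and> unique_minimizer g y (flow g y s) s}"
      then have s: "s > 0" "minimizer g y (flow g y s) s"
        by (auto simp: unique_minimizer_def)
      obtain v where "v \<noteq> 0" and
        ker: "v + (1 / (norm (grad g y) / t)) *\<^sub>R (H y v - (sgn (grad g y) \<bullet> H y v) *\<^sub>R sgn (grad g y)) = 0"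
        using det det_jacobian_flow_eq_0_iff[OF hess y, of t] by auto
      have v: "sgn (grad g y) \<bullet> v = 0" "H y v \<bullet> v + norm (grad g y) / t * (norm v)\<^sup>2 = 0"
        using sphere_flow_kernel_imp_null[OF _ _ ker] y \<open>t > 0\<close> by (auto simp: norm_sgn)
      \<comment> \<open>The form vanishes at \<open>v\<close> for the radius \<open>t\<close> and would be negative there for a larger radius \<open>s\<close>.\<close>
      then have "0 \<le> H y v \<bullet> v + norm (grad g y) / s * (norm v)\<^sup>2"
        using y by (intro psd s) (simp_all add: sgn_div_norm)
      then have "norm (grad g y) / t * (norm v)\<^sup>2 \<le> norm (grad g y) / s * (norm v)\<^sup>2"
        using v(2) by linarith
      then have "s \<le> t"
        using \<open>v \<noteq> 0\<close> y \<open>t > 0\<close> \<open>s > 0\<close> by (simp add: field_simps)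
      then show "ennreal s \<le> ennreal t"
        by (rule ennreal_leI)
    qed
    then have "y \<in> M_set g"
      using y by (auto simp: M_set_def intro: order_le_less_trans)
    then have "p \<in> TM_set g"
      unfolding TM_set_def p using t_bar_le le_t_s \<open>t > 0\<close> by force
    then show "p \<in> T1_set g"
      using uniq p by (auto simp: T1_set_def)
  qed
qed

end
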